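(* Let $S$ be a commutative semiring with $1\neq 0$ and let $M$ be a unital $S$-semimodule. If $M$ has a $1$-absorbing prime subsemimodule that is not prime, then $S$ is a local semiring.
   Context: For a subsemimodule $N$ of $M$, $(N:_S M)=\{s\in S\mid sM\subseteq N\}$. A proper subsemimodule $N$ of $M$ is $1$-absorbing prime if for all nonunits $a,b\in S$ and all $m\in M$, $abm\in N$ implies $ab\in (N:_S M)$ or $m\in N$. A proper subsemimodule $N$ of $M$ is prime if for all $a\in S$ and $m\in M$, $am\in N$ implies $a\in (N:_S M)$ or $m\in N$. A semiring $S$ is local if it has exactly one maximal ideal; equivalently, the sum of two nonunits of $S$ is a nonunit of $S$. *)

theory Defs
  imports Main
begin

text \<open>
  The semiring \<open>S\<close> is the type \<open>'a\<close> of class \<^class>\<open>comm_semiring_1\<close>, whose axioms include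
  \<open>0 * a = 0\<close> and \<open>0 \<noteq> 1\<close>. The semimodule \<open>M\<close> is the type \<open>'b\<close>. The axioms \<open>scale_zero_left\<close> and
  \<open>scale_zero_right\<close> have to be stated, because they do not follow from the others without
  subtraction.
\<close>

locale semimodule =
  fixes scale :: "'a::comm_semiring_1 \<Rightarrow> 'b::comm_monoid_add \<Rightarrow> 'b" (infixr "*s" 75)
  assumes scale_right_distrib: "a *s (x + y) = a *s x + a *s y"
    and scale_left_distrib: "(a + b) *s x = a *s x + b *s x"
    and scale_scale: "a *s (b *s x) = (a * b) *s x"
    and scale_one: "1 *s x = x"
    and scale_zero_left: "0 *s x = 0"
    and scale_zero_right: "a *s 0 = 0"
begin

definition subsemimodule :: "'b set \<Rightarrow> bool" where
  "subsemimodule N \<longleftrightarrow>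
     0 \<in> N \<and> (\<forall>x\<in>N. \<forall>y\<in>N. x + y \<in> N) \<and> (\<forall>a. \<forall>x\<in>N. a *s x \<in> N)"

definition proper_subsemimodule :: "'b set \<Rightarrow> bool" where
  "proper_subsemimodule N \<longleftrightarrow> subsemimodule N \<and> N \<noteq> UNIV"

text \<open>The residual \<open>(N :\<^sub>S M)\<close>; the set \<open>s M\<close> is \<open>range (scale s)\<close>.\<close>

definition residual :: "'b set \<Rightarrow> 'a set" where
  "residual N = {s. range (scale s) \<subseteq> N}"

definition prime_subsemimodule :: "'b set \<Rightarrow> bool" where
  "prime_subsemimodule N \<longleftrightarrow> proper_subsemimodule N \<and>
     (\<forall>a m. a *s m \<in> N \<longrightarrow> a \<in> residual N \<or> m \<in> N)"

text \<open>Units are the divisors of \<open>1\<close>; the abbreviation \<open>is_unit\<close> is confined to cancellative domains.\<close>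

definition one_absorbing_prime_subsemimodule :: "'b set \<Rightarrow> bool" where
  "one_absorbing_prime_subsemimodule N \<longleftrightarrow> proper_subsemimodule N \<and>
     (\<forall>a b m. \<not> a dvd 1 \<longrightarrow> \<not> b dvd 1 \<longrightarrow> (a * b) *s m \<in> N \<longrightarrow>
        a * b \<in> residual N \<or> m \<in> N)"

end

definition semiring_ideal :: "'a::comm_semiring_1 set \<Rightarrow> bool" where
  "semiring_ideal I \<longleftrightarrow>
     0 \<in> I \<and> (\<forall>x\<in>I. \<forall>y\<in>I. x + y \<in> I) \<and> (\<forall>a. \<forall>x\<in>I. a * x \<in> I)"

definition maximal_semiring_ideal :: "'a::comm_semiring_1 set \<Rightarrow> bool" where
  "maximal_semiring_ideal I \<longleftrightarrow> semiring_ideal I \<and> I \<noteq> UNIV \<and>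
     (\<forall>J. semiring_ideal J \<longrightarrow> I \<subseteq> J \<longrightarrow> J = I \<or> J = UNIV)"

text \<open>A property of the semiring as a whole, so it takes the type as argument.\<close>

definition local_semiring :: "'a::comm_semiring_1 itself \<Rightarrow> bool" where
  "local_semiring _ \<longleftrightarrow> (\<exists>!I :: 'a set. maximal_semiring_ideal I)"

end

theory Submission
  imports Defs
begin

text \<open>
  A failure of primality is a pair \<open>a\<close>, \<open>m\<close> with \<open>a m \<in> N\<close>, \<open>m \<notin> N\<close> and \<open>a \<notin> (N : M)\<close>. Such an
  \<open>a\<close> is a nonunit, and for every nonunit \<open>b\<close> the element \<open>(b a) m = b (a m)\<close> lies in \<open>N\<close>, so
  1-absorption forces \<open>b a \<in> (N : M)\<close>. Hence the nonunits all lie in \<open>((N : M) : a)\<close>. This set is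
  closed under addition and contains no unit, because \<open>a \<notin> (N : M)\<close>; so a sum of two nonunits is
  never a unit.

  The set of nonunits is then an ideal. Every proper ideal consists of nonunits, so
  it is the only maximal ideal.
\<close>

lemma semiring_ideal_eq_UNIV_if_unit:
  assumes "semiring_ideal I" and "u \<in> I" and "u dvd 1"
  shows "I = UNIV"
proof -
  obtain v where v: "u * v = 1"
    using \<open>u dvd 1\<close> by (metis dvdE)
  have "x \<in> I" for x
  proof -
    have "(x * v) * u \<in> I"
      using assms(1,2) by (auto simp: semiring_ideal_def)
    also have "(x * v) * u = x * (u * v)"
      by (simp only: ac_simps)
    also have "\<dots> = x"
      by (simp add: v)
    finally show ?thesis .
  qed
  then show ?thesis by auto
qed

text \<open>
  Closure of the nonunits under addition is the only ideal axiom that can fail for them: \<open>0\<close> is a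
  nonunit since \<open>0 \<noteq> 1\<close>, and a factor of a unit is a unit.
\<close>

lemma local_semiring_if_nonunits_add:
  assumes add: "\<And>b c :: 'a::comm_semiring_1.
    \<not> b dvd 1 \<Longrightarrow> \<not> c dvd 1 \<Longrightarrow> \<not> b + c dvd 1"
  shows "local_semiring TYPE('a)"
proof -
  let ?U = "{x :: 'a. \<not> x dvd 1}"
  have ideal: "semiring_ideal ?U"
    by (auto simp: semiring_ideal_def add dest: dvd_mult_right)
  have proper: "?U \<noteq> UNIV"
    using dvd_refl[of "1 :: 'a"] by blast
  have below: "I \<subseteq> ?U" if "semiring_ideal I" "I \<noteq> UNIV" for I
    using that semiring_ideal_eq_UNIV_if_unit by blast
  have "maximal_semiring_ideal ?U"
    unfolding maximal_semiring_ideal_def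
  proof (intro conjI allI impI ideal proper)
    fix J :: "'a set"
    assume "semiring_ideal J" and "?U \<subseteq> J"
    with below[of J] show "J = ?U \<or> J = UNIV"
      by (metis subset_antisym)
  qed
  moreover have "I = ?U" if I: "maximal_semiring_ideal I" for I
  proof -
    have "I \<subseteq> ?U"
      using I below by (simp add: maximal_semiring_ideal_def)
    then have "?U = I \<or> ?U = UNIV"
      using I ideal by (simp only: maximal_semiring_ideal_def)
    with proper show ?thesis by metis
  qed
  ultimately show ?thesis
    unfolding local_semiring_def by (rule ex1I)
qed

context semimodule
begin

lemma residual_iff: "s \<in> residual N \<longleftrightarrow> (\<forall>x. s *s x \<in> N)"
  by (auto simp: residual_def)

lemma residual_add:
  assumes "subsemimodule N" and "s \<in> residual N" and "t \<in> residual N"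
  shows "s + t \<in> residual N"
  using assms by (auto simp: residual_iff subsemimodule_def scale_left_distrib)

lemma scale_in_subsemimodule:
  assumes "subsemimodule N" and "x \<in> N"
  shows "a *s x \<in> N"
  using assms by (auto simp: subsemimodule_def)

lemma residual_mult_left:
  assumes "subsemimodule N" and "s \<in> residual N"
  shows "t * s \<in> residual N"
  using assms by (auto simp: residual_iff scale_in_subsemimodule simp flip: scale_scale)

lemma unit_scale_in_subsemimodule_cancel:
  assumes "subsemimodule N" and "u dvd 1" and "u *s x \<in> N"
  shows "x \<in> N"
proof -
  obtain v where "v * u = 1"
    using \<open>u dvd 1\<close> by (metis dvdE mult.commute)
  then have "v *s (u *s x) = x"
    by (simp add: scale_scale scale_one)
  then show ?thesis
    using scale_in_subsemimodule[OF assms(1,3), of v] by simp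
qed

text \<open>
  If \<open>a\<close> witnesses the failure of primality and \<open>(b + c) v = 1\<close>, then \<open>v (b a + c a) = a\<close>;
  absorption puts the left-hand side into the residual, which \<open>a\<close> avoids.
\<close>

lemma nonunits_add_if_one_absorbing_not_prime:
  fixes b c :: 'a
  assumes abs: "one_absorbing_prime_subsemimodule N"
    and not_prime: "\<not> prime_subsemimodule N"
    and b: "\<not> b dvd 1" and c: "\<not> c dvd 1"
  shows "\<not> b + c dvd 1"
proof
  assume "b + c dvd 1"
  then obtain v where v: "(b + c) * v = 1"
    by (metis dvdE)
  have N: "subsemimodule N" and proper: "proper_subsemimodule N"
    using abs by (auto simp: one_absorbing_prime_subsemimodule_def proper_subsemimodule_def)
  obtain a m where am: "a *s m \<in> N" "a \<notin> residual N" "m \<notin> N"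
    using not_prime proper by (auto simp: prime_subsemimodule_def)
  have a: "\<not> a dvd 1"
    using unit_scale_in_subsemimodule_cancel[OF N] am by blast
  have absorb: "d * a \<in> residual N" if "\<not> d dvd 1" for d
  proof -
    have "(d * a) *s m \<in> N"
      using scale_in_subsemimodule[OF N am(1)] by (simp flip: scale_scale)
    then show ?thesis
      using abs that a am(3) unfolding one_absorbing_prime_subsemimodule_def by blast
  qed
  have "v * (b * a + c * a) \<in> residual N"
    by (rule residual_mult_left[OF N residual_add[OF N absorb[OF b] absorb[OF c]]])
  also have "v * (b * a + c * a) = ((b + c) * v) * a"
    by (simp add: algebra_simps)
  also have "\<dots> = a"
    by (simp only: v mult_1)
  finally show False
    using am(2) by contradiction
qed

end

theorem theorem2p4:
  fixes scale :: "'a::comm_semiring_1 \<Rightarrow> 'b::comm_monoid_add \<Rightarrow> 'b"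
  assumes "semimodule scale"
    and "\<exists>N. semimodule.one_absorbing_prime_subsemimodule scale N
           \<and> \<not> semimodule.prime_subsemimodule scale N"
  shows "local_semiring TYPE('a)"
  using assms(2) semimodule.nonunits_add_if_one_absorbing_not_prime[OF assms(1)]
  by (blast intro: local_semiring_if_nonunits_add)

end
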